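(* Let $(C_1,C_2,C_3)$ be a complex hyperbolic triangle with normalised polar vectors $c_1,c_2,c_3$, let $r_k=|\langle c_{k-1},c_{k+1}\rangle|$, and let $\alpha$ be its angular invariant. Let $\mu_1,\mu_2,\mu_3$ be unit complex numbers and let $\iota_k=\iota_{C_k}^{\mu_k}$ be the complex $\mu_k$-reflection in $C_k$. Let $a=(a_1,\dots,a_n)$ be a word with letters in $\{1,2,3\}$, $\iota_a=\iota_{a_1}\cdots\iota_{a_n}$ the corresponding element of the group generated by $\iota_1,\iota_2,\iota_3$, and $\tau_a$ the trace of $\iota_a$. Then $$\tau_a=2+\sum_{S\subset[n]}\left(\prod_{k=1}^3(\mu_k-1)^{n_k(S)}\right)\cdot\left(\prod_{k=1}^3 r_k^{u_k(S)}\right)\cdot e^{i\alpha w(S)},$$ where the sum is over all subsets $S$ of $[n]=\{1,\dots,n\}$ (including the empty one).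
   Context: $\mathbb C^{2,1}$ is $\mathbb C^3$ with the Hermitian form $\langle z,w\rangle=z_1\bar w_1+z_2\bar w_2-z_3\bar w_3$. The complex hyperbolic plane $H^2_{\mathbb C}$ is the projectivisation of the set of vectors with $\langle z,z\rangle<0$. A complex geodesic $C$ is the projectivisation (intersected with $H^2_{\mathbb C}$) of the orthogonal complement of a vector $c$ with $\langle c,c\rangle>0$; $c$ is called a polar vector of $C$, normalised if $\langle c,c\rangle=1$. A complex hyperbolic triangle is a triple $(C_1,C_2,C_3)$ of complex geodesics. Indices of $c_k$, $r_k$ are mod 3. The angular invariant is $\alpha=\arg\left(\prod_{k=1}^3\langle c_{k-1},c_{k+1}\rangle\right)$ (mod $2\pi$), where the product is assumed nonzero so that this is defined. The complex $\mu_k$-reflection in $C_k$ is represented by the linear map $\iota_k(z)=z+(\mu_k-1)\langle z,c_k\rangle c_k$ on $\mathbb C^{2,1}$, and traces are traces of products of these linear maps. Combinatorial functions of words $b=(b_1,\dots,b_m)$ in the letters $1,2,3$, with $b_{m+1}:=b_1$: let $\chi(x)\in\{-1,0,1\}$ be the integer congruent to $x$ modulo $3$; $w(b)=\frac13\sum_{j=1}^m\chi(b_{j+1}-b_j)$; $u_k(b)=|\{j\in\{1,\dots,m\}:\{b_j,b_{j+1}\}=\{k-1,k+1\}\}|$ (with $k\pm1$ taken mod 3 in $\{1,2,3\}$); $n_k(b)=|\{j\in\{1,\dots,m\}: b_j=k\}|$. All are $0$ for the empty word, and $0^0=1$. For $S=\{i_1<\dots<i_m\}\subset[n]$, $n_k(S),u_k(S),w(S)$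 denote the values on the subsequence $(a_{i_1},\dots,a_{i_m})$ of $a$. *)

theory Defs
  imports "HOL-Analysis.Analysis"
begin

text \<open>Indices and letters live in the type \<^typ>\<open>3\<close> of integers modulo 3, whose elements are
  1, 2, 3 with \<^prop>\<open>(3::3) = 0\<close>; so \<open>k - 1\<close> and \<open>k + 1\<close> are automatically taken modulo 3.\<close>

definition herm :: "complex^3 \<Rightarrow> complex^3 \<Rightarrow> complex" where
  "herm z w = z$1 * cnj (w$1) + z$2 * cnj (w$2) - z$3 * cnj (w$3)"

text \<open>Points of the projective plane are one-dimensional subspaces of \<open>\<complex>\<^sup>3\<close>. The value
  \<^term>\<open>herm z z\<close> is always real, so its sign is that of its real part.\<close>

definition complex_hyperbolic_plane :: "(complex^3) set set" where
  "complex_hyperbolic_plane = {vec.span {z} | z. Re (herm z z) < 0}"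

definition polar_vector :: "complex^3 \<Rightarrow> (complex^3) set set \<Rightarrow> bool" where
  "polar_vector c C \<longleftrightarrow>
     Re (herm c c) > 0 \<and> C = {p \<in> complex_hyperbolic_plane. p \<subseteq> {z. herm z c = 0}}"

definition normalised_polar_vector :: "complex^3 \<Rightarrow> (complex^3) set set \<Rightarrow> bool" where
  "normalised_polar_vector c C \<longleftrightarrow> polar_vector c C \<and> herm c c = 1"

definition complex_geodesic :: "(complex^3) set set \<Rightarrow> bool" where
  "complex_geodesic C \<longleftrightarrow> (\<exists>c. polar_vector c C)"

definition complex_hyperbolic_triangle :: "(3 \<Rightarrow> (complex^3) set set) \<Rightarrow> bool" where
  "complex_hyperbolic_triangle C \<longleftrightarrow> (\<forall>k. complex_geodesic (C k))"

definition triangle_r :: "(3 \<Rightarrow> complex^3) \<Rightarrow> 3 \<Rightarrow> real" where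
  "triangle_r c k = cmod (herm (c (k - 1)) (c (k + 1)))"

text \<open>The angular invariant is only defined modulo \<open>2\<pi>\<close>, hence a predicate that holds of
  every real representative of the argument.\<close>

definition angular_invariant :: "(3 \<Rightarrow> complex^3) \<Rightarrow> real \<Rightarrow> bool" where
  "angular_invariant c \<alpha> \<longleftrightarrow> is_Arg (\<Prod>k\<in>UNIV. herm (c (k - 1)) (c (k + 1))) \<alpha>"

text \<open>The linear map representing the complex \<open>\<mu>\<close>-reflection in the complex geodesic with
  normalised polar vector \<open>c\<close>.\<close>

definition complex_reflection :: "complex \<Rightarrow> complex^3 \<Rightarrow> complex^3 \<Rightarrow> complex^3" where
  "complex_reflection \<mu> c z = z + ((\<mu> - 1) * herm z c) *s c"

definition word_map :: "(3 \<Rightarrow> complex) \<Rightarrow> (3 \<Rightarrow> complex^3) \<Rightarrow> 3 list \<Rightarrow> complex^3 \<Rightarrow> complex^3" where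
  "word_map \<mu> c a = foldr (\<circ>) (map (\<lambda>k. complex_reflection (\<mu> k) (c k)) a) id"

definition word_trace :: "(3 \<Rightarrow> complex) \<Rightarrow> (3 \<Rightarrow> complex^3) \<Rightarrow> 3 list \<Rightarrow> complex" where
  "word_trace \<mu> c a = trace (matrix (word_map \<mu> c a))"

definition chi3 :: "3 \<Rightarrow> int" where
  "chi3 x = (THE i. i \<in> {-1, 0, 1} \<and> of_int i = x)"

lemma chi3_simps [simp]: "chi3 0 = 0" "chi3 1 = 1" "chi3 2 = -1" "chi3 3 = 0"
  unfolding chi3_def by (rule the_equality; force)+

text \<open>Words are 0-indexed lists, read cyclically: the letter following position \<open>j\<close> is at
  position \<open>Suc j mod length b\<close>.\<close>

definition word_w :: "3 list \<Rightarrow> real" where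
  "word_w b = 1 / 3 * (\<Sum>j<length b. of_int (chi3 (b ! (Suc j mod length b) - b ! j)))"

definition word_u :: "3 \<Rightarrow> 3 list \<Rightarrow> nat" where
  "word_u k b = card {j. j < length b \<and> {b ! j, b ! (Suc j mod length b)} = {k - 1, k + 1}}"

definition word_n :: "3 \<Rightarrow> 3 list \<Rightarrow> nat" where
  "word_n k b = card {j. j < length b \<and> b ! j = k}"

end

theory Submission
  imports Defs
begin

text \<open>Write each reflection as the identity plus \<open>\<mu> - 1\<close> times the rank-one map
  \<open>z \<mapsto> \<langle>z, c\<rangle> c\<close> and expand the product: the subset \<open>S\<close> contributes the trace of a composition of
  rank-one maps, which is the cyclic product of the Gram entries \<open>\<langle>c\<^bsub>y\<^esub>, c\<^bsub>x\<^esub>\<rangle>\<close> over consecutive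
  letters \<open>x, y\<close>. Rescaling the polar vectors by suitable phases makes each of
  \<open>\<langle>c\<^sub>2, c\<^sub>1\<rangle>\<close>, \<open>\<langle>c\<^sub>3, c\<^sub>2\<rangle>\<close>, \<open>\<langle>c\<^sub>1, c\<^sub>3\<rangle>\<close> a positive multiple of \<open>exp (\<i>\<alpha>/3)\<close>, and
  these phases cancel in cyclic products.\<close>

section \<open>Sums over subwords and products around a cycle\<close>

lemma sum_Pow_nths_Cons:
  fixes f :: "'a list \<Rightarrow> 'b::comm_monoid_add"
  shows "(\<Sum>S\<in>Pow {..<length (x # a)}. f (nths (x # a) S)) =
    (\<Sum>S\<in>Pow {..<length a}. f (x # nths a S)) + (\<Sum>S\<in>Pow {..<length a}. f (nths a S))"
proof -
  let ?P = "Pow {..<length a}"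
  have inj: "inj_on ((`) Suc) ?P"
    by (simp add: inj_on_def inj_image_eq_iff)
  have inj': "inj_on (\<lambda>S. insert 0 (Suc ` S)) ?P"
    by (auto simp: inj_on_def set_eq_iff image_iff)
  \<comment> \<open>A set of positions either contains position 0 or not; in both cases the rest is
    a \<open>Suc\<close>-shifted set of positions of \<open>a\<close>.\<close>
  have "{..<length (x # a)} = insert 0 (Suc ` {..<length a})"
    by (simp add: lessThan_Suc_eq_insert_0)
  then have "Pow {..<length (x # a)} = (\<lambda>S. insert 0 (Suc ` S)) ` ?P \<union> (`) Suc ` ?P"
    by (auto simp: Pow_insert image_Pow_surj [OF refl, symmetric] image_image)
  moreover have "(\<lambda>S. insert 0 (Suc ` S)) ` ?P \<inter> (`) Suc ` ?P = {}"
    by auto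
  ultimately show ?thesis
    by (simp add: sum.union_disjoint sum.reindex inj inj' nths_Cons image_iff)
qed

text \<open>Only \<open>S = {}\<close> selects the empty subword. This lets the exceptional trace of
  the empty composition leave the sum as a constant.\<close>

lemma sum_Pow_nths_empty:
  "(\<Sum>S\<in>Pow {..<length a}. if nths a S = [] then r else (0::'b::comm_monoid_add)) = r"
proof (induction a)
  case (Cons x a)
  then show ?case
    unfolding sum_Pow_nths_Cons [where f = "\<lambda>b. if b = [] then r else 0"] by simp
qed simp

text \<open>The cyclic successor permutes the positions. Hence factors \<open>e y / e x\<close> over
  consecutive letters cancel around a word.\<close>

lemma prod_cyclic_shift:
  fixes f :: "'a \<Rightarrow> 'b::comm_monoid_mult"
  shows "(\<Prod>j<length b. f (b ! (Suc j mod length b))) = (\<Prod>j<length b. f (b ! j))"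
proof (cases b)
  case (Cons x b')
  have "(\<Prod>j<length b'. f (b ! (Suc j mod length b))) = (\<Prod>j<length b'. f (b ! Suc j))"
    by (intro prod.cong) (simp_all add: Cons)
  moreover have "(\<Prod>j<length b. f (b ! j)) = f x * (\<Prod>j<length b'. f (b ! Suc j))"
    by (simp add: Cons prod.lessThan_Suc_shift del: prod.lessThan_Suc)
  ultimately show ?thesis
    by (simp add: Cons mult.commute)
qed simp

section \<open>Traces of compositions of rank-one maps\<close>

definition gram_cycle :: "(3 \<Rightarrow> complex^3) \<Rightarrow> 3 list \<Rightarrow> complex" where
  "gram_cycle c b = (\<Prod>j<length b. herm (c (b ! (Suc j mod length b))) (c (b ! j)))"

definition rank_one :: "complex^3 \<Rightarrow> complex^3 \<Rightarrow> complex^3" where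
  "rank_one c z = herm z c *s c"

definition rank_one_word :: "(3 \<Rightarrow> complex^3) \<Rightarrow> 3 list \<Rightarrow> complex^3 \<Rightarrow> complex^3" where
  "rank_one_word c b = foldr (\<circ>) (map (\<lambda>k. rank_one (c k)) b) id"

lemma rank_one_word_simps [simp]:
  "rank_one_word c [] z = z"
  "rank_one_word c (x # b) z = rank_one (c x) (rank_one_word c b z)"
  by (simp_all add: rank_one_word_def)

lemma herm_scale_left: "herm (s *s z) w = s * herm z w"
  by (simp add: herm_def algebra_simps)

lemma herm_sum_left: "herm (\<Sum>i\<in>I. f i) w = (\<Sum>i\<in>I. herm (f i) w)"
  by (simp add: herm_def sum.distrib sum_subtractf sum_distrib_right)

lemma herm_commute: "herm w z = cnj (herm z w)"
  by (simp add: herm_def mult.commute)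

text \<open>The innermost map pairs \<open>z\<close> with the vector of the last letter; every
  further map pairs the vector just produced with its own. The product is still open: the factor
  joining the first letter to the last appears only on taking the trace.\<close>

lemma rank_one_word_Cons:
  "rank_one_word c (x # b) z =
    (herm z (c (last (x # b))) * (\<Prod>j<length b. herm (c ((x # b) ! Suc j)) (c ((x # b) ! j)))) *s c x"
proof (induction b arbitrary: x)
  case Nil
  then show ?case by (simp add: rank_one_def)
next
  case (Cons y b)
  have "rank_one_word c (x # y # b) z = rank_one (c x) (rank_one_word c (y # b) z)"
    by simp
  also have "\<dots> = (herm z (c (last (y # b))) *
      (\<Prod>j<length b. herm (c ((y # b) ! Suc j)) (c ((y # b) ! j))) * herm (c y) (c x)) *s c x"
    by (simp only: Cons.IH) (simp add: rank_one_def herm_scale_left)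
  finally show ?case
    by (simp add: prod.lessThan_Suc_shift mult_ac del: rank_one_word_simps prod.lessThan_Suc)
qed

lemma trace_matrix: "trace (matrix f) = (\<Sum>i\<in>UNIV. f (axis i 1) $ i)"
  by (simp add: trace_def matrix_def)

text \<open>This evaluates the trace of the rank-one map sending \<open>z\<close> to
  \<open>herm z v *s w\<close>.\<close>

lemma herm_axis: "(\<Sum>i\<in>UNIV. herm (axis i 1) v * w $ i) = herm w v"
  by (simp add: herm_def sum_3 axis_def algebra_simps)

text \<open>The empty composition is the identity, of trace 3, while the empty product is 1; the
  difference is the 2 of the trace formula.\<close>

lemma trace_rank_one_word:
  "trace (matrix (rank_one_word c b)) = gram_cycle c b + (if b = [] then 2 else 0)"
proof (cases b)
  case Nil
  then show ?thesis
    by (simp add: trace_matrix gram_cycle_def sum_3 axis_def)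
next
  case (Cons x b')
  let ?p = "\<Prod>j<length b'. herm (c ((x # b') ! Suc j)) (c ((x # b') ! j))"
  have "trace (matrix (rank_one_word c b)) =
      (\<Sum>i\<in>UNIV. ?p * (herm (axis i 1) (c (last (x # b'))) * c x $ i))"
    unfolding trace_matrix Cons rank_one_word_Cons by (simp add: mult_ac)
  also have "\<dots> = ?p * herm (c x) (c (last (x # b')))"
    unfolding sum_distrib_left [symmetric] herm_axis ..
  also have "\<dots> = gram_cycle c b"
  proof -
    \<comment> \<open>Only the last position wraps around, and its factor is the closing one;
      elsewhere the reduction modulo the length does nothing.\<close>
    have "?p = (\<Prod>j<length b'. herm (c (b ! (Suc j mod length b))) (c (b ! j)))"
      by (intro prod.cong) (simp_all add: Cons)
    then show ?thesis
      by (simp add: gram_cycle_def Cons last_conv_nth)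
  qed
  finally show ?thesis
    by (simp add: Cons)
qed

section \<open>Expansion of the trace over subwords\<close>

definition letter_weight :: "(3 \<Rightarrow> complex) \<Rightarrow> 3 list \<Rightarrow> complex" where
  "letter_weight \<mu> b = (\<Prod>k\<in>UNIV. (\<mu> k - 1) ^ word_n k b)"

lemma word_n_simps [simp]:
  "word_n k [] = 0"
  "word_n k (x # b) = (if x = k then 1 else 0) + word_n k b"
proof -
  have *: "word_n k l = length (filter (\<lambda>y. y = k) l)" for l
    by (simp add: word_n_def length_filter_conv_card)
  show "word_n k [] = 0" "word_n k (x # b) = (if x = k then 1 else 0) + word_n k b"
    by (simp_all add: *)
qed

lemma letter_weight_simps [simp]:
  "letter_weight \<mu> [] = 1"
  "letter_weight \<mu> (x # b) = (\<mu> x - 1) * letter_weight \<mu> b"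
proof -
  have "(\<mu> k - 1) ^ word_n k (x # b) = (if x = k then \<mu> k - 1 else 1) * (\<mu> k - 1) ^ word_n k b" for k
    by simp
  then show "letter_weight \<mu> (x # b) = (\<mu> x - 1) * letter_weight \<mu> b"
    by (simp only: letter_weight_def prod.distrib) simp
qed (simp add: letter_weight_def)

text \<open>Induction on the word: in the outermost reflection, the rank-one term accounts for the
  subsets containing the first position and the identity for the others.\<close>

lemma word_map_expand:
  "word_map \<mu> c a z =
    (\<Sum>S\<in>Pow {..<length a}. letter_weight \<mu> (nths a S) *s rank_one_word c (nths a S) z)"
proof (induction a)
  case Nil
  then show ?case by (simp add: word_map_def)
next
  case (Cons x a)
  let ?f = "\<lambda>S. letter_weight \<mu> (nths a S) *s rank_one_word c (nths a S) z"
  have "word_map \<mu> c (x # a) z = complex_reflection (\<mu> x) (c x) (word_map \<mu> c a z)"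
    by (simp add: word_map_def)
  also have "\<dots> = ((\<mu> x - 1) * herm (\<Sum>S\<in>Pow {..<length a}. ?f S) (c x)) *s c x
      + (\<Sum>S\<in>Pow {..<length a}. ?f S)"
    by (simp add: Cons.IH complex_reflection_def)
  also have "((\<mu> x - 1) * herm (\<Sum>S\<in>Pow {..<length a}. ?f S) (c x)) *s c x =
      (\<Sum>S\<in>Pow {..<length a}. letter_weight \<mu> (x # nths a S) *s rank_one_word c (x # nths a S) z)"
    by (simp add: herm_sum_left herm_scale_left rank_one_def sum_distrib_left
        vec.scale_sum_left mult_ac)
  finally show ?case
    unfolding sum_Pow_nths_Cons [where f = "\<lambda>b. letter_weight \<mu> b *s rank_one_word c b z"] .
qed

lemma word_trace_expand:
  "word_trace \<mu> c a =
    2 + (\<Sum>S\<in>Pow {..<length a}. letter_weight \<mu> (nths a S) * gram_cycle c (nths a S))"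
proof -
  have "word_trace \<mu> c a = (\<Sum>S\<in>Pow {..<length a}. \<Sum>i\<in>UNIV.
      letter_weight \<mu> (nths a S) * rank_one_word c (nths a S) (axis i 1) $ i)"
    unfolding word_trace_def trace_matrix word_map_expand
    by (subst sum.swap) simp
  also have "\<dots> = (\<Sum>S\<in>Pow {..<length a}.
      letter_weight \<mu> (nths a S) * trace (matrix (rank_one_word c (nths a S))))"
    by (simp add: trace_matrix sum_distrib_left)
  \<comment> \<open>The correction 2 belongs to the empty subword, whose letter weight is 1.\<close>
  also have "\<dots> = (\<Sum>S\<in>Pow {..<length a}. (if nths a S = [] then 2 else 0)
      + letter_weight \<mu> (nths a S) * gram_cycle c (nths a S))"
    by (intro sum.cong) (simp_all add: trace_rank_one_word distrib_left)
  finally show ?thesis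
    by (simp add: sum.distrib sum_Pow_nths_empty)
qed

section \<open>Moduli and phases of the Gram entries\<close>

definition edge_weight :: "(3 \<Rightarrow> complex) \<Rightarrow> 3 \<Rightarrow> 3 \<Rightarrow> complex" where
  "edge_weight r x y = (\<Prod>k\<in>UNIV. if {x, y} = {k - 1, k + 1} then r k else 1)"

lemma prod_edge_weight:
  "(\<Prod>j<length b. edge_weight r (b ! j) (b ! (Suc j mod length b))) = (\<Prod>k\<in>UNIV. r k ^ word_u k b)"
proof -
  have "(\<Prod>j<length b. if {b ! j, b ! (Suc j mod length b)} = {k - 1, k + 1} then r k else 1)
      = r k ^ word_u k b" for k
    by (simp add: prod.If_cases word_u_def Int_def)
  then show ?thesis
    unfolding edge_weight_def by (subst prod.swap) simp
qed

lemma num3_pred_succ: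
  "(1::3) - 1 = 3" "(2::3) - 1 = 1" "(3::3) - 1 = 2"
  "(1::3) + 1 = 2" "(2::3) + 1 = 3" "(3::3) + 1 = 1"
  by simp_all

lemma chi3_diff:
  "chi3 (x - x) = 0"
  "chi3 (2 - 1) = 1" "chi3 (3 - 2) = 1" "chi3 (1 - 3) = 1"
  "chi3 (1 - 2) = -1" "chi3 (2 - 3) = -1" "chi3 (3 - 1) = -1"
proof -
  have "(2::3) - 1 = 1" "(3::3) - 2 = 1" "(1::3) - 3 = 1"
    "(1::3) - 2 = 2" "(2::3) - 3 = 2" "(3::3) - 1 = 2"
    by simp_all
  then show "chi3 (x - x) = 0"
    "chi3 (2 - 1) = 1" "chi3 (3 - 2) = 1" "chi3 (1 - 3) = 1"
    "chi3 (1 - 2) = -1" "chi3 (2 - 3) = -1" "chi3 (3 - 1) = -1"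
    by (simp_all only: diff_self chi3_simps)
qed

lemma prod_3: "(\<Prod>k\<in>(UNIV::3 set). f k) = f 1 * f 2 * (f 3 :: 'a::comm_monoid_mult)"
proof -
  have "(\<Prod>k\<in>(UNIV::3 set). f k) = (\<Prod>k\<in>{1, 2, 3}. f k)"
    by (simp only: UNIV_3)
  then show ?thesis
    by (simp add: mult.assoc)
qed

text \<open>Two distinct letters form \<open>{k - 1, k + 1}\<close> for exactly one
  \<open>k\<close>, the third letter; a repeated letter matches no \<open>k\<close>.\<close>

lemma edge_weight_values:
  "edge_weight r x x = 1"
  "edge_weight r 1 2 = r 3" "edge_weight r 2 1 = r 3"
  "edge_weight r 2 3 = r 1" "edge_weight r 3 2 = r 1"
  "edge_weight r 3 1 = r 2" "edge_weight r 1 3 = r 2"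
  using exhaust_3[of x]
  by (auto simp: edge_weight_def prod_3 num3_pred_succ doubleton_eq_iff)

text \<open>Along the oriented edges 1 to 2, 2 to 3 and 3 to 1 the phases add up to \<alpha>, so
  factors \<open>e y / e x\<close> can spread this total evenly over the three edges. The sign
  \<open>chi3 (y - x)\<close> records the direction of travel.\<close>

lemma phase_normalisation:
  assumes unit: "\<And>k. herm (c k) (c k) = 1"
    and nz: "(\<Prod>k\<in>UNIV. herm (c (k - 1)) (c (k + 1))) \<noteq> 0"
    and ang: "angular_invariant c \<alpha>"
  obtains e :: "3 \<Rightarrow> complex" where "\<And>k. e k \<noteq> 0"
    and "\<And>x y. herm (c y) (c x) = edge_weight (\<lambda>k. of_real (triangle_r c k)) x y
      * exp (\<i> * of_real (\<alpha> / 3 * of_int (chi3 (y - x)))) * (e y / e x)"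
proof -
  define A where "A = herm (c 2) (c 1)"
  define B where "B = herm (c 3) (c 2)"
  define D where "D = herm (c 1) (c 3)"
  define \<epsilon> where "\<epsilon> = exp (\<i> * of_real (\<alpha> / 3))"
  \<comment> \<open>Starting from \<open>e 1 = 1\<close>, the required relations on the edges 1 to 2
    and 2 to 3 are solved for \<open>e 2\<close> and \<open>e 3\<close>.\<close>
  define e :: "3 \<Rightarrow> complex" where "e k = (if k = 1 then 1 else
    if k = 2 then A / (cmod A * \<epsilon>) else A * B / (cmod A * cmod B * \<epsilon>\<^sup>2))" for k
  have prod: "(\<Prod>k\<in>UNIV. herm (c (k - 1)) (c (k + 1))) = A * B * D"
    by (simp only: prod_3 num3_pred_succ A_def B_def D_def mult_ac)
  have nonzero: "A \<noteq> 0" "B \<noteq> 0" "D \<noteq> 0"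
    using nz unfolding prod by auto
  have r: "triangle_r c 1 = cmod B" "triangle_r c 2 = cmod D" "triangle_r c 3 = cmod A"
    by (simp_all only: triangle_r_def A_def B_def D_def num3_pred_succ)
  have \<epsilon>: "\<epsilon> \<noteq> 0" "cmod \<epsilon> = 1"
    by (simp_all add: \<epsilon>_def)
  have "\<epsilon> ^ 3 = exp (\<i> * of_real \<alpha>)"
    unfolding \<epsilon>_def exp_of_nat_mult [symmetric] by simp
  then have ABD: "A * B * D = cmod A * cmod B * cmod D * \<epsilon> ^ 3"
    using ang unfolding angular_invariant_def is_Arg_def prod by (simp add: norm_mult)
  have e_values: "e 1 = 1" "e 2 = A / (cmod A * \<epsilon>)" "e 3 = A * B / (cmod A * cmod B * \<epsilon>\<^sup>2)"
    by (simp_all add: e_def)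
  have e_norm: "cmod (e k) = 1" for k
    using nonzero by (simp add: e_def norm_divide norm_mult norm_power \<epsilon>)
  have e_nonzero: "e k \<noteq> 0" for k
    using e_norm [of k] by auto
  have forward: "A = cmod A * \<epsilon> * (e 2 / e 1)" "B = cmod B * \<epsilon> * (e 3 / e 2)"
    using nonzero \<epsilon>(1) by (simp_all add: e_values field_simps power2_eq_square)
  \<comment> \<open>No freedom is left on the third edge; its relation holds because the total phase
    is that of \<open>\<epsilon> ^ 3\<close>.\<close>
  have forward': "D = cmod D * \<epsilon> * (e 1 / e 3)"
    using nonzero \<epsilon>(1) ABD by (simp add: e_values field_simps power2_eq_square power3_eq_cube)
  \<comment> \<open>On the unit circle conjugation is inversion, so conjugating the relation of an
    edge yields that of the reversed edge.\<close>
  have cnj_e: "cnj (e k) = 1 / e k" for k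
    using e_norm [of k] e_nonzero [of k] complex_norm_square [of "e k"]
    by (simp add: field_simps)
  have "cnj \<epsilon> = exp (- (\<i> * of_real (\<alpha> / 3)))"
    by (simp add: \<epsilon>_def exp_cnj)
  then have backward: "cnj z = cmod z * exp (- (\<i> * of_real (\<alpha> / 3))) * (e x / e y)"
    if "z = cmod z * \<epsilon> * (e y / e x)" for x y z
    using arg_cong [OF that, of cnj] by (simp add: cnj_e)
  have gram: "herm (c y) (c x) = edge_weight (\<lambda>k. of_real (triangle_r c k)) x y
      * exp (\<i> * of_real (\<alpha> / 3 * of_int (chi3 (y - x)))) * (e y / e x)" for x y
  proof -
    have forth: "herm (c 2) (c 1) = cmod A * \<epsilon> * (e 2 / e 1)"
      "herm (c 3) (c 2) = cmod B * \<epsilon> * (e 3 / e 2)"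
      "herm (c 1) (c 3) = cmod D * \<epsilon> * (e 1 / e 3)"
      using forward forward' by (simp_all only: A_def B_def D_def)
    have "herm (c 1) (c 2) = cnj A" "herm (c 2) (c 3) = cnj B" "herm (c 3) (c 1) = cnj D"
      by (simp_all add: A_def B_def D_def herm_commute [symmetric])
    then have reversed:
      "herm (c 1) (c 2) = cmod A * exp (- (\<i> * of_real (\<alpha> / 3))) * (e 1 / e 2)"
      "herm (c 2) (c 3) = cmod B * exp (- (\<i> * of_real (\<alpha> / 3))) * (e 2 / e 3)"
      "herm (c 3) (c 1) = cmod D * exp (- (\<i> * of_real (\<alpha> / 3))) * (e 3 / e 1)"
      using backward [OF forward(1)] backward [OF forward(2)] backward [OF forward'] by simp_all
    consider "x = y" | "x = 1" "y = 2" | "x = 2" "y = 3" | "x = 3" "y = 1"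
      | "x = 2" "y = 1" | "x = 3" "y = 2" | "x = 1" "y = 3"
      using exhaust_3 [of x] exhaust_3 [of y] by blast
    then show ?thesis
      by cases (simp_all only: unit forth reversed edge_weight_values r chi3_diff,
        simp_all add: e_nonzero \<epsilon>_def)
  qed
  show ?thesis
    by (rule that [OF e_nonzero gram])
qed

theorem theorem10:
  fixes C :: "3 \<Rightarrow> (complex^3) set set"
    and c :: "3 \<Rightarrow> complex^3"
    and \<mu> :: "3 \<Rightarrow> complex"
    and \<alpha> :: real
    and a :: "3 list"
  assumes "complex_hyperbolic_triangle C"
    and "\<And>k. normalised_polar_vector (c k) (C k)"
    and "(\<Prod>k\<in>UNIV. herm (c (k - 1)) (c (k + 1))) \<noteq> 0"
    and "angular_invariant c \<alpha>"
    and "\<And>k. cmod (\<mu> k) = 1"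
  shows "word_trace \<mu> c a =
    2 + (\<Sum>S\<in>Pow {..<length a}.
           (\<Prod>k\<in>UNIV. (\<mu> k - 1) ^ word_n k (nths a S))
         * (\<Prod>k\<in>UNIV. of_real (triangle_r c k) ^ word_u k (nths a S))
         * exp (\<i> * of_real (\<alpha> * word_w (nths a S))))"
proof -
  have unit: "\<And>k. herm (c k) (c k) = 1"
    using assms(2) by (simp add: normalised_polar_vector_def)
  obtain e where e: "\<And>k. e k \<noteq> 0"
    and gram: "\<And>x y. herm (c y) (c x) = edge_weight (\<lambda>k. of_real (triangle_r c k)) x y
      * exp (\<i> * of_real (\<alpha> / 3 * of_int (chi3 (y - x)))) * (e y / e x)"
    using phase_normalisation [OF unit assms(3,4)] by blast
  have "gram_cycle c b = (\<Prod>k\<in>UNIV. of_real (triangle_r c k) ^ word_u k b)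
      * exp (\<i> * of_real (\<alpha> * word_w b))" for b
  proof -
    let ?s = "\<lambda>j. Suc j mod length b"
    have "(\<Prod>j<length b. e (b ! ?s j) / e (b ! j)) = 1"
      by (simp add: prod_dividef prod_cyclic_shift e)
    \<comment> \<open>The exponents add up, and the division of \<alpha> by 3 becomes the factor 1/3
      in \<open>word_w\<close>.\<close>
    moreover have "(\<Prod>j<length b. exp (\<i> * of_real (\<alpha> / 3 * of_int (chi3 (b ! ?s j - b ! j)))))
        = exp (\<i> * of_real (\<alpha> * word_w b))"
      by (simp add: exp_sum [symmetric] word_w_def sum_distrib_left sum_divide_distrib)
    ultimately show ?thesis
      unfolding gram_cycle_def gram prod.distrib prod_edge_weight by simp
  qed
  then show ?thesis
    by (simp add: word_trace_expand letter_weight_def mult.assoc)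
qed

end
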